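(* Let $R$ be a hyperbolic automorphism of $\mathbb{Z}^2$ and let $G_R=\mathbb{Z}^2\rtimes_R\mathbb{Z}$. Let $\{a,b\}$ be the standard generating set for $\mathbb{Z}^2$ and $\{c\}$ be that for $\mathbb{Z}$. Then $G_R$ has arbitrarily deep dead ends with respect to $\{a,b,c\}$; that is, for every integer $K$ there is an element of $G_R$ whose depth with respect to $\{a,b,c\}$ is greater than $K$.
   Context: An automorphism $R\in GL_2(\mathbb{Z})$ is hyperbolic if it has no eigenvalue of absolute value $1$ (it then has two real eigenvalues $\tau$ and $\pm1/\tau$ with $|\tau|>1$). In $G_R$ the generator $c$ acts on $\mathbb{Z}^2$ by $c^{-1}hc=R(h)$ for $h\in\mathbb{Z}^2$. For an infinite group $G$ with finite generating set $A$, $d_A$ denotes the word metric, and the depth of $g\in G$ with respect to $A$ is the $d_A$-distance from $g$ to the complement in $G$ of the closed ball of radius $d_A(1,g)$ about the identity. An element of depth greater than $1$ is called a dead end. *)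

theory Defs
  imports "HOL-Analysis.Analysis" "HOL-Algebra.Generated_Groups"
begin

definition word_prod :: "('g, 'm) monoid_scheme \<Rightarrow> 'g list \<Rightarrow> 'g" where
  "word_prod G ws = foldr (mult G) ws (one G)"

text \<open>Lengths and distances are natural numbers. The two infima below are over nonempty sets when
  \<open>A\<close> is finite and generates the infinite group \<open>G\<close>; otherwise the convention
  \<open>Inf {} = 0\<close> on \<open>nat\<close> may apply.\<close>

definition word_length :: "('g, 'm) monoid_scheme \<Rightarrow> 'g set \<Rightarrow> 'g \<Rightarrow> nat" where
  "word_length G A g =
     Inf {length ws | ws. set ws \<subseteq> A \<union> m_inv G ` A \<and> word_prod G ws = g}"

definition word_dist :: "('g, 'm) monoid_scheme \<Rightarrow> 'g set \<Rightarrow> 'g \<Rightarrow> 'g \<Rightarrow> nat" where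
  "word_dist G A g h = word_length G A (inv\<^bsub>G\<^esub> g \<otimes>\<^bsub>G\<^esub> h)"

definition word_cball :: "('g, 'm) monoid_scheme \<Rightarrow> 'g set \<Rightarrow> 'g \<Rightarrow> nat \<Rightarrow> 'g set" where
  "word_cball G A g n = {h \<in> carrier G. word_dist G A g h \<le> n}"

definition depth :: "('g, 'm) monoid_scheme \<Rightarrow> 'g set \<Rightarrow> 'g \<Rightarrow> nat" where
  "depth G A g =
     (INF h \<in> carrier G - word_cball G A \<one>\<^bsub>G\<^esub> (word_dist G A \<one>\<^bsub>G\<^esub> g). word_dist G A g h)"

text \<open>The product of matrices is \<open>**\<close>; on \<open>int^2^2\<close> the operations \<open>*\<close> and \<open>^\<close> are
  componentwise.\<close>

definition GL2Z :: "(int^2^2) monoid" where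
  "GL2Z = \<lparr>carrier = {M. invertible M}, mult = (**), one = mat 1\<rparr>"

text \<open>Eigenvalues are complex: a nonreal eigenvalue of an element of \<open>GL\<^sub>2(\<int>)\<close> has modulus \<open>1\<close>.\<close>

definition complex_eigenvalue :: "int^2^2 \<Rightarrow> complex \<Rightarrow> bool" where
  "complex_eigenvalue M l \<longleftrightarrow> (\<exists>v :: complex^2. v \<noteq> 0 \<and> map_matrix of_int M *v v = l *s v)"

definition hyperbolic :: "int^2^2 \<Rightarrow> bool" where
  "hyperbolic M \<longleftrightarrow> M \<in> carrier GL2Z \<and> (\<forall>l. complex_eigenvalue M l \<longrightarrow> cmod l \<noteq> 1)"

text \<open>The pair \<open>(h, k)\<close> stands for \<open>h c\<^sup>k\<close>. Since \<open>c\<^sup>-\<^sup>1 h c = R(h)\<close>, we have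
  \<open>h c\<^sup>k h' c\<^sup>l = (h + R\<^sup>-\<^sup>k(h')) c\<^sup>k\<^sup>+\<^sup>l\<close>.\<close>

definition semidirect :: "int^2^2 \<Rightarrow> ((int^2) \<times> int) monoid" where
  "semidirect R =
     \<lparr>carrier = UNIV,
      mult = (\<lambda>(h, k) (h', l). (h + (R [^]\<^bsub>GL2Z\<^esub> (- k)) *v h', k + l)),
      one = (0, 0)\<rparr>"

definition gen_a :: "(int^2) \<times> int" where "gen_a = (axis 1 1, 0)"
definition gen_b :: "(int^2) \<times> int" where "gen_b = (axis 2 1, 0)"
definition gen_c :: "(int^2) \<times> int" where "gen_c = (0, 1)"

lemma group_GL2Z: "group GL2Z"
proof (rule groupI)
  fix x y assume "x \<in> carrier GL2Z" "y \<in> carrier GL2Z"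
  then obtain x' y' where "x ** x' = mat 1" "x' ** x = mat 1" "y ** y' = mat 1" "y' ** y = mat 1"
    unfolding GL2Z_def invertible_def by auto
  then have "(x ** y) ** (y' ** x') = mat 1" "(y' ** x') ** (x ** y) = mat 1"
    by (metis matrix_mul_assoc matrix_mul_rid)+
  then show "x \<otimes>\<^bsub>GL2Z\<^esub> y \<in> carrier GL2Z"
    unfolding GL2Z_def invertible_def by auto
next
  fix x assume "x \<in> carrier GL2Z"
  then show "\<exists>y\<in>carrier GL2Z. y \<otimes>\<^bsub>GL2Z\<^esub> x = \<one>\<^bsub>GL2Z\<^esub>"
    unfolding GL2Z_def invertible_def by auto
next
  show "\<one>\<^bsub>GL2Z\<^esub> \<in> carrier GL2Z"
    unfolding GL2Z_def invertible_def by (auto intro!: exI[of _ "mat 1"])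
qed (auto simp: GL2Z_def matrix_mul_assoc)

lemma GL2Z_one [simp]: "\<one>\<^bsub>GL2Z\<^esub> = mat 1"
  by (simp add: GL2Z_def)

lemma GL2Z_pow_add:
  "R \<in> carrier GL2Z \<Longrightarrow>
    R [^]\<^bsub>GL2Z\<^esub> (i + j :: int) = (R [^]\<^bsub>GL2Z\<^esub> i) ** (R [^]\<^bsub>GL2Z\<^esub> j)"
  using group.int_pow_mult[OF group_GL2Z, of R i j] by (simp add: GL2Z_def)

lemma semidirect_carrier [simp]: "carrier (semidirect R) = UNIV"
  by (simp add: semidirect_def)

lemma semidirect_one: "\<one>\<^bsub>semidirect R\<^esub> = (0, 0)"
  by (simp add: semidirect_def)

lemma semidirect_mult:
  "(h, k) \<otimes>\<^bsub>semidirect R\<^esub> (h', l) = (h + (R [^]\<^bsub>GL2Z\<^esub> (- k)) *v h', k + l)"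
  by (simp add: semidirect_def)

lemma group_semidirect:
  assumes R: "R \<in> carrier GL2Z"
  shows "group (semidirect R)"
proof (rule groupI)
  fix x y z :: "(int^2) \<times> int"
  obtain h1 k1 h2 k2 h3 k3 where [simp]: "x = (h1, k1)" "y = (h2, k2)" "z = (h3, k3)"
    by (metis surj_pair)
  show "x \<otimes>\<^bsub>semidirect R\<^esub> y \<otimes>\<^bsub>semidirect R\<^esub> z = x \<otimes>\<^bsub>semidirect R\<^esub> (y \<otimes>\<^bsub>semidirect R\<^esub> z)"
    using GL2Z_pow_add[OF R, of "- k1" "- k2"]
    by (simp add: semidirect_mult matrix_vector_right_distrib matrix_vector_mul_assoc)
next
  fix x :: "(int^2) \<times> int"
  obtain h k where x: "x = (h, k)" by (metis surj_pair)
  have "(- ((R [^]\<^bsub>GL2Z\<^esub> k) *v h), - k) \<otimes>\<^bsub>semidirect R\<^esub> x = \<one>\<^bsub>semidirect R\<^esub>"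
    by (simp add: x semidirect_mult semidirect_one)
  then show "\<exists>y\<in>carrier (semidirect R). y \<otimes>\<^bsub>semidirect R\<^esub> x = \<one>\<^bsub>semidirect R\<^esub>"
    by auto
next
  fix x :: "(int^2) \<times> int"
  show "\<one>\<^bsub>semidirect R\<^esub> \<otimes>\<^bsub>semidirect R\<^esub> x = x"
    by (cases x) (simp add: semidirect_mult semidirect_one)
qed auto

lemma semidirect_conj:
  assumes R: "R \<in> carrier GL2Z"
  shows "inv\<^bsub>semidirect R\<^esub> gen_c \<otimes>\<^bsub>semidirect R\<^esub> (h, 0) \<otimes>\<^bsub>semidirect R\<^esub> gen_c = (R *v h, 0)"
proof -
  interpret G: group "semidirect R" by (rule group_semidirect[OF R])
  have "inv\<^bsub>semidirect R\<^esub> gen_c = (0, - 1)"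
    by (rule G.inv_equality) (auto simp: gen_c_def semidirect_mult semidirect_one)
  moreover have "R [^]\<^bsub>GL2Z\<^esub> (1::int) = R"
    using group.int_pow_1[OF group_GL2Z R] .
  ultimately show ?thesis
    by (simp add: gen_c_def semidirect_mult)
qed

lemma semidirect_generate:
  assumes R: "R \<in> carrier GL2Z"
  shows "generate (semidirect R) {gen_a, gen_b, gen_c} = carrier (semidirect R)"
proof -
  let ?G = "semidirect R"
  let ?H = "generate ?G {gen_a, gen_b, gen_c}"
  interpret G: group ?G by (rule group_semidirect[OF R])
  interpret H: subgroup ?H ?G by (rule G.generate_is_subgroup) simp
  have pow_h: "(h, 0) [^]\<^bsub>?G\<^esub> (n::nat) = (int n *s h, 0)" for h n
    by (induction n)
      (simp_all add: nat_pow_def semidirect_one semidirect_mult vec_eq_iff algebra_simps)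
  have pow_c: "gen_c [^]\<^bsub>?G\<^esub> (n::nat) = (0, int n)" for n
    by (induction n) (simp_all add: nat_pow_def semidirect_one semidirect_mult gen_c_def)
  have inv_h: "inv\<^bsub>?G\<^esub> (h, 0) = (- h, 0)" for h
    by (rule G.inv_equality) (auto simp: semidirect_mult semidirect_one)
  have inv_c: "inv\<^bsub>?G\<^esub> (0, k) = (0, - k)" for k
    by (rule G.inv_equality) (auto simp: semidirect_mult semidirect_one)
  have powH: "x [^]\<^bsub>?G\<^esub> (n::nat) \<in> ?H" if "x \<in> ?H" for x n
    using that by (induction n) (auto simp: G.nat_pow_Suc)
  have h_in: "(i *s h, 0) \<in> ?H" if "(h, 0) \<in> ?H" for h :: "int^2" and i :: int
  proof (cases "i \<ge> 0")
    case True
    then show ?thesis using powH[OF that, of "nat i"] pow_h[of h "nat i"] by simp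
  next
    case False
    then have "(- (int (nat (- i)) *s h), 0) \<in> ?H"
      using H.m_inv_closed[OF powH[OF that, of "nat (- i)"]] pow_h inv_h by simp
    moreover have "- (int (nat (- i)) *s h) = i *s h"
      using False by (simp add: vec_eq_iff)
    ultimately show ?thesis by simp
  qed
  have c_in: "(0, k) \<in> ?H" for k :: int
  proof -
    have gc: "gen_c \<in> ?H" by (simp add: generate.incl)
    show ?thesis
    proof (cases "k \<ge> 0")
      case True
      then show ?thesis using powH[OF gc, of "nat k"] pow_c by simp
    next
      case False
      then show ?thesis
        using H.m_inv_closed[OF powH[OF gc, of "nat (- k)"]] pow_c inv_c by simp
    qed
  qed
  have "(h, k) \<in> ?H" for h :: "int^2" and k :: int
  proof -
    have "(axis 1 1, 0) \<in> ?H" "(axis 2 1, 0) \<in> ?H"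
      unfolding gen_a_def gen_b_def by (auto intro: generate.incl)
    then have "((h $ 1) *s axis 1 1, 0) \<in> ?H" "((h $ 2) *s axis 2 1, 0) \<in> ?H"
      by (auto intro: h_in)
    then have "((h $ 1) *s axis 1 1, 0) \<otimes>\<^bsub>?G\<^esub> ((h $ 2) *s axis 2 1, 0) \<otimes>\<^bsub>?G\<^esub> (0, k) \<in> ?H"
      using c_in by simp
    moreover have "(h $ 1) *s axis 1 1 + (h $ 2) *s axis 2 1 = h"
      by (simp add: vec_eq_iff forall_2 axis_def)
    ultimately show ?thesis by (simp add: semidirect_mult)
  qed
  then show ?thesis by auto
qed

end

theory Submission
  imports Defs
begin

text \<open>
  Let \<open>f\<close> be the word length of \<open>G\<^sub>R\<close> restricted to the lattice \<open>\<int>\<^sup>2\<close>. The dead ends are lattice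
  points at which \<open>f\<close> has a local maximum on a large scale, and such points exist because \<open>f\<close>
  grows more slowly than every linear function.

  Sublinearity: since \<open>R\<^sup>2 + R\<^sup>-\<^sup>2\<close> is multiplication by an integer \<open>T \<ge> 3\<close>, and applying \<open>R\<^sup>\<plusminus>\<^sup>2\<close> costs only
  four letters, division with remainder gives \<open>f (T q + r) \<le> 2 f q + 8 + \<bar>r\<bar>\<close>. As \<open>2 / T < 1\<close>, iterating
  yields \<open>f h \<le> \<epsilon> \<bar>h\<bar> + D\<close> for every \<open>\<epsilon> > 0\<close> (\<open>len_sublinear\<close>).

  Local maxima: to beat all lattice points at distance less than \<open>W\<close>, maximise the penalised function
  \<open>W f h - \<bar>h - h\<^sub>0\<bar>\<close>, which is bounded above by sublinearity (\<open>penalised_maximum\<close>). A step shorter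
  than \<open>W\<close> changes the penalty by less than \<open>W\<close>, hence cannot raise the integer \<open>f\<close>. Comparison with
  \<open>h\<^sub>0\<close> gives \<open>\<bar>h - h\<^sub>0\<bar> \<le> W f h\<close>, so the maximum stays close to the chosen base point \<open>h\<^sub>0\<close>.

  Leaving the lattice: an element near \<open>(h, 0)\<close> has the form \<open>(h', k)\<close> with \<open>h'\<close> near \<open>h\<close> and \<open>\<bar>k\<bar>\<close>
  small, so \<open>(h', k)\<close> must not be longer than \<open>(h', 0)\<close>. A word is a cursor moving on \<open>\<int>\<close>; a lattice letter
  \<open>x\<close> written at position \<open>p\<close> contributes \<open>R\<^sup>-\<^sup>p x\<close>. Sorting the letters by position shows that the cheapest
  word with cursor range \<open>{m..M}\<close> and digits \<open>x\<^sub>p\<close> ending at \<open>k\<close> has length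
  \<open>2 (M - m) - \<bar>k\<bar> + \<Sum> \<bar>x\<^sub>p\<bar>\<close> (\<open>digits_of_word\<close>, \<open>len_digits\<close>). Ending at \<open>k\<close> is thus no dearer than ending
  at \<open>0\<close> if an optimal word for \<open>(h', 0)\<close> visits \<open>k\<close>. It does when \<open>h'\<close> is far from
  both eigenlines of \<open>R\<close>: a word whose cursor stays below \<open>K\<close> (or above \<open>- K\<close>) moves the coordinate
  along the contracting (or expanding) eigenvector only by a constant times its length, and the
  length is sublinear (\<open>len_move_cursor\<close>). Therefore \<open>h\<^sub>0\<close> is taken to be a large multiple of a basis
  vector; no eigenline contains one, because \<open>R\<close> would otherwise have an eigenvalue \<open>\<plusminus>1\<close>.
\<close>

section \<open>Word length in a group\<close>

context group
begin

lemma word_prod_closed: "set ws \<subseteq> carrier G \<Longrightarrow> word_prod G ws \<in> carrier G"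
  by (induction ws) (auto simp: word_prod_def)

lemma word_prod_append:
  assumes "set xs \<subseteq> carrier G" "set ys \<subseteq> carrier G"
  shows "word_prod G (xs @ ys) = word_prod G xs \<otimes> word_prod G ys"
  using assms
proof (induction xs)
  case Nil
  then show ?case using word_prod_closed[of ys] by (simp add: word_prod_def)
next
  case (Cons x xs)
  then show ?case
    using word_prod_closed[of xs] word_prod_closed[of ys] by (simp add: word_prod_def m_assoc)
qed

text \<open>Reversing a word and inverting its letters permutes the alphabet of generators and their inverses;
  this makes word length invariant under inversion.\<close>

lemma word_prod_inv:
  assumes "set ws \<subseteq> carrier G"
  shows "word_prod G (rev (map (m_inv G) ws)) = inv (word_prod G ws)"
  using assms
proof (induction ws)
  case Nil
  then show ?case by (simp add: word_prod_def)
next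
  case (Cons w ws)
  have closed: "set (rev (map (m_inv G) ws)) \<subseteq> carrier G" "set [inv w] \<subseteq> carrier G"
    using Cons.prems by auto
  have "word_prod G (rev (map (m_inv G) (w # ws)))
      = word_prod G (rev (map (m_inv G) ws)) \<otimes> word_prod G [inv w]"
    using word_prod_append[OF closed] by simp
  also have "\<dots> = inv (word_prod G ws) \<otimes> inv w"
    using Cons by (simp add: word_prod_def)
  also have "\<dots> = inv (word_prod G (w # ws))"
    using Cons.prems word_prod_closed[of ws] by (simp add: word_prod_def inv_mult_group)
  finally show ?case .
qed

lemma word_length_le:
  "set ws \<subseteq> A \<union> m_inv G ` A \<Longrightarrow> word_length G A (word_prod G ws) \<le> length ws"
  unfolding word_length_def by (rule cInf_lower) auto

context
  fixes A :: "'a set"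
  assumes A_closed: "A \<subseteq> carrier G" and A_gen: "generate G A = carrier G"
begin

lemma letters_closed: "A \<union> m_inv G ` A \<subseteq> carrier G"
  using A_closed by auto

lemma word_exists:
  assumes "g \<in> carrier G"
  obtains ws where "set ws \<subseteq> A \<union> m_inv G ` A" "word_prod G ws = g"
proof -
  have "g \<in> generate G A" using assms A_gen by simp
  then have "\<exists>ws. set ws \<subseteq> A \<union> m_inv G ` A \<and> word_prod G ws = g"
  proof (induction rule: generate.induct)
    case one
    then show ?case by (auto simp: word_prod_def intro: exI[of _ "[]"])
  next
    case (incl h)
    then show ?case using A_closed by (auto simp: word_prod_def intro!: exI[of _ "[h]"])
  next
    case (inv h)
    then show ?case using A_closed by (auto simp: word_prod_def intro!: exI[of _ "[inv h]"])
  next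
    case (eng h1 h2)
    then obtain ws1 ws2 where ws: "set ws1 \<subseteq> A \<union> m_inv G ` A" "word_prod G ws1 = h1"
      "set ws2 \<subseteq> A \<union> m_inv G ` A" "word_prod G ws2 = h2" by blast
    then have "word_prod G (ws1 @ ws2) = h1 \<otimes> h2"
      using letters_closed word_prod_append[of ws1 ws2] by blast
    then show ?case using ws by (intro exI[of _ "ws1 @ ws2"]) auto
  qed
  then show thesis using that by blast
qed

lemma geodesic_word:
  assumes "g \<in> carrier G"
  obtains ws where "set ws \<subseteq> A \<union> m_inv G ` A" "word_prod G ws = g" "length ws = word_length G A g"
proof -
  let ?L = "{length ws | ws. set ws \<subseteq> A \<union> m_inv G ` A \<and> word_prod G ws = g}"
  obtain ws where "set ws \<subseteq> A \<union> m_inv G ` A" "word_prod G ws = g"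
    by (rule word_exists[OF assms])
  then have "length ws \<in> ?L" by (intro CollectI exI[of _ ws]) simp
  then have "?L \<noteq> {}" by (metis empty_iff)
  then have "word_length G A g \<in> ?L" unfolding word_length_def by (rule Inf_nat_def1)
  then obtain ws where "set ws \<subseteq> A \<union> m_inv G ` A" "word_prod G ws = g" "word_length G A g = length ws"
    by blast
  then show thesis using that[of ws] by simp
qed

lemma word_length_mult:
  assumes "g \<in> carrier G" "h \<in> carrier G"
  shows "word_length G A (g \<otimes> h) \<le> word_length G A g + word_length G A h"
proof -
  obtain us where us: "set us \<subseteq> A \<union> m_inv G ` A" "word_prod G us = g" "length us = word_length G A g"
    using geodesic_word[OF assms(1)] by blast
  obtain vs where vs: "set vs \<subseteq> A \<union> m_inv G ` A" "word_prod G vs = h" "length vs = word_length G A h"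
    using geodesic_word[OF assms(2)] by blast
  have "set us \<subseteq> carrier G" "set vs \<subseteq> carrier G" using us(1) vs(1) letters_closed by auto
  then have "word_prod G (us @ vs) = g \<otimes> h" using us(2) vs(2) by (simp add: word_prod_append)
  then show ?thesis using word_length_le[of "us @ vs" A] us vs by simp
qed

lemma word_length_inv_le:
  assumes "g \<in> carrier G"
  shows "word_length G A (inv g) \<le> word_length G A g"
proof -
  obtain ws where ws: "set ws \<subseteq> A \<union> m_inv G ` A" "word_prod G ws = g" "length ws = word_length G A g"
    using geodesic_word[OF assms] by blast
  have "set ws \<subseteq> carrier G" using ws(1) letters_closed by auto
  then have "word_prod G (rev (map (m_inv G) ws)) = inv g" using ws(2) by (simp add: word_prod_inv)
  moreover have "set (rev (map (m_inv G) ws)) \<subseteq> A \<union> m_inv G ` A"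
  proof
    fix y assume "y \<in> set (rev (map (m_inv G) ws))"
    then obtain w where "w \<in> set ws" "y = inv w" by auto
    then show "y \<in> A \<union> m_inv G ` A" using ws(1) A_closed by (auto simp: subset_iff)
  qed
  ultimately show ?thesis using word_length_le[of "rev (map (m_inv G) ws)" A] ws(3) by simp
qed

lemma finite_word_length_le:
  assumes "finite A"
  shows "finite {g \<in> carrier G. word_length G A g \<le> n}"
proof (rule finite_subset)
  show "{g \<in> carrier G. word_length G A g \<le> n}
      \<subseteq> word_prod G ` {ws. set ws \<subseteq> A \<union> m_inv G ` A \<and> length ws \<le> n}"
  proof
    fix g assume "g \<in> {g \<in> carrier G. word_length G A g \<le> n}"
    then have g: "g \<in> carrier G" "word_length G A g \<le> n" by auto
    obtain ws where "set ws \<subseteq> A \<union> m_inv G ` A" "word_prod G ws = g" "length ws = word_length G A g"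
      using geodesic_word[OF g(1)] by blast
    then show "g \<in> word_prod G ` {ws. set ws \<subseteq> A \<union> m_inv G ` A \<and> length ws \<le> n}"
      using g(2) by (intro image_eqI[of _ _ ws]) auto
  qed
  show "finite (word_prod G ` {ws. set ws \<subseteq> A \<union> m_inv G ` A \<and> length ws \<le> n})"
    using assms by (intro finite_imageI finite_lists_length_le) auto
qed

text \<open>The existence of a longer element rules out that the infimum defining the depth is taken over the
  empty set, where it would be \<open>0\<close>.\<close>

lemma depth_greaterI:
  assumes g: "g \<in> carrier G"
    and longer: "\<exists>h \<in> carrier G. word_length G A g < word_length G A h"
    and near: "\<And>s. s \<in> carrier G \<Longrightarrow> word_length G A s \<le> n \<Longrightarrow>
      word_length G A (g \<otimes> s) \<le> word_length G A g"
  shows "n < depth G A g"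
proof -
  let ?S = "carrier G - word_cball G A \<one> (word_dist G A \<one> g)"
  have S: "h \<in> ?S \<longleftrightarrow> h \<in> carrier G \<and> word_length G A g < word_length G A h" for h
    using g by (auto simp: word_cball_def word_dist_def)
  have "word_dist G A g ` ?S \<noteq> {}" using longer S by blast
  then have "depth G A g \<in> word_dist G A g ` ?S"
    unfolding depth_def by (rule Inf_nat_def1)
  then obtain h where h: "h \<in> carrier G" "word_length G A g < word_length G A h"
    and d: "depth G A g = word_length G A (inv g \<otimes> h)"
    using S by (auto simp: word_dist_def)
  have "g \<otimes> (inv g \<otimes> h) = h" using g h(1) by (simp add: m_assoc[symmetric])
  then show ?thesis using near[of "inv g \<otimes> h"] g h d by force
qed

end

end

section \<open>Word length in the semidirect product\<close>

abbreviation len :: "int^2^2 \<Rightarrow> (int^2) \<times> int \<Rightarrow> nat" where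
  "len R \<equiv> word_length (semidirect R) {gen_a, gen_b, gen_c}"

abbreviation letters :: "((int^2) \<times> int) set" where
  "letters \<equiv> {(axis 1 1, 0), (axis 2 1, 0), (0, 1), (- axis 1 1, 0), (- axis 2 1, 0), (0, - 1)}"

definition l1 :: "int^2 \<Rightarrow> int" where "l1 h = \<bar>h $ 1\<bar> + \<bar>h $ 2\<bar>"

lemma l1_nonneg: "0 \<le> l1 h"
  by (simp add: l1_def)

lemma l1_triangle: "l1 (x + y) \<le> l1 x + l1 y"
  by (simp add: l1_def)

lemma l1_minus [simp]: "l1 (- x) = l1 x"
  by (simp add: l1_def)

lemma axis_decomp: "(h $ 1) *s axis 1 1 + (h $ 2) *s axis 2 1 = (h :: int^2)"
  by (simp add: vec_eq_iff forall_2 axis_def)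

lemma matrix_vector_mult_minus: "(M :: int^2^2) *v (- x) = - (M *v x)"
  by (simp add: vec_eq_iff matrix_vector_mult_def sum_negf)

lemma matrix_vector_mult_sum: "(M :: int^2^2) *v (\<Sum>p\<in>I. f p) = (\<Sum>p\<in>I. M *v f p)"
  by (induction I rule: infinite_finite_induct) (simp_all add: matrix_vector_right_distrib)

context
  fixes R :: "int^2^2"
  assumes R: "R \<in> carrier GL2Z"
begin

interpretation G: group "semidirect R"
  by (rule group_semidirect[OF R])

lemmas pow_add = GL2Z_pow_add[OF R]

lemma semidirect_inv:
  "inv\<^bsub>semidirect R\<^esub> (h, k) = (- ((R [^]\<^bsub>GL2Z\<^esub> k) *v h), - k)"
  by (rule G.inv_equality) (auto simp: semidirect_mult semidirect_one)

lemma gens_closed: "{gen_a, gen_b, gen_c} \<subseteq> carrier (semidirect R)"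
  by simp

lemmas generators = gens_closed semidirect_generate[OF R]

lemma letters_eq:
  "{gen_a, gen_b, gen_c} \<union> m_inv (semidirect R) ` {gen_a, gen_b, gen_c} =
   letters"
  by (auto simp: gen_a_def gen_b_def gen_c_def semidirect_inv)

lemma len_mult: "len R (g \<otimes>\<^bsub>semidirect R\<^esub> h) \<le> len R g + len R h"
  by (rule G.word_length_mult[OF generators]) auto

lemma len_mult_le: "len R g \<le> m \<Longrightarrow> len R h \<le> n \<Longrightarrow> len R (g \<otimes>\<^bsub>semidirect R\<^esub> h) \<le> m + n"
  using len_mult[of g h] by linarith

lemma len_add: "len R (h + h', 0) \<le> len R (h, 0) + len R (h', 0)"
  using len_mult[of "(h, 0)" "(h', 0)"] by (simp add: semidirect_mult)

lemma len_letter: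
  assumes "l \<in> letters"
  shows "len R l \<le> 1"
  using G.word_length_le[of "[l]" "{gen_a, gen_b, gen_c}"] assms unfolding letters_eq
  by (simp add: word_prod_def)

lemma len_one: "len R (0, 0) = 0"
  using G.word_length_le[of "[]" "{gen_a, gen_b, gen_c}"] by (simp add: word_prod_def semidirect_one)

lemma len_multiple:
  assumes "len R (y, 0) \<le> 1" "len R (- y, 0) \<le> 1"
  shows "int (len R (i *s y, 0)) \<le> \<bar>i\<bar>"
proof -
  have nat: "len R (int n *s z, 0) \<le> n" if "len R (z, 0) \<le> 1" for n z
  proof (induction n)
    case 0
    then show ?case by (simp add: len_one)
  next
    case (Suc n)
    have "int (Suc n) *s z = int n *s z + z" by (simp add: vec_eq_iff algebra_simps)
    moreover have "len R (int n *s z + z, 0) \<le> Suc n"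
      using len_add[of "int n *s z" z] Suc that by linarith
    ultimately show ?case by (simp only:)
  qed
  show ?thesis
  proof (cases "i \<ge> 0")
    case True
    then show ?thesis using nat[OF assms(1), of "nat i"] by simp
  next
    case False
    then have "int (nat (- i)) *s (- y) = i *s y" by (simp add: vec_eq_iff)
    then show ?thesis using nat[OF assms(2), of "nat (- i)"] False by simp
  qed
qed

lemma len_le_l1: "int (len R (x, 0)) \<le> l1 x"
proof -
  have "int (len R (x $ 1 *s axis 1 1, 0)) \<le> \<bar>x $ 1\<bar>" "int (len R (x $ 2 *s axis 2 1, 0)) \<le> \<bar>x $ 2\<bar>"
    by (rule len_multiple; rule len_letter; simp)+
  then show ?thesis
    using len_add[of "x $ 1 *s axis 1 1" "x $ 2 *s axis 2 1"] unfolding axis_decomp l1_def by linarith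
qed

lemma len_c_pow: "int (len R (0, k)) \<le> \<bar>k\<bar>"
proof -
  have nat: "len R (0, int n * e) \<le> n" if "e = 1 \<or> e = - 1" for n e
  proof (induction n)
    case 0
    then show ?case by (simp add: len_one)
  next
    case (Suc n)
    have "len R ((0, int n * e) \<otimes>\<^bsub>semidirect R\<^esub> (0, e)) \<le> n + 1"
      using that by (intro len_mult_le Suc len_letter) auto
    moreover have "(0, int n * e) \<otimes>\<^bsub>semidirect R\<^esub> (0, e) = (0, int (Suc n) * e)"
      by (simp add: semidirect_mult algebra_simps)
    ultimately show ?case by simp
  qed
  show ?thesis using nat[of 1 "nat k"] nat[of "- 1" "nat (- k)"] by (cases "k \<ge> 0") auto
qed

text \<open>Lattice elements are distorted because conjugating by \<open>c\<^sup>j\<close> applies \<open>R\<^sup>j\<close>, which expands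
  exponentially in \<open>j\<close>, at linear cost.\<close>

lemma len_pow: "int (len R ((R [^]\<^bsub>GL2Z\<^esub> j) *v h, 0)) \<le> int (len R (h, 0)) + 2 * \<bar>j\<bar>"
proof -
  have "len R ((0, - j) \<otimes>\<^bsub>semidirect R\<^esub> (h, 0) \<otimes>\<^bsub>semidirect R\<^esub> (0, j))
      \<le> len R (0, - j) + len R (h, 0) + len R (0, j)"
    by (intro len_mult_le order_refl)
  then show ?thesis
    using len_c_pow[of j] len_c_pow[of "- j"] by (simp add: semidirect_mult)
qed

section \<open>Digit expansions\<close>

text \<open>The lattice part of a word that writes the digit \<open>x p\<close> while its cursor is at \<open>p\<close>, for \<open>p\<close> between
  \<open>m\<close> and \<open>M\<close>.\<close>

definition digit_sum :: "int \<Rightarrow> int \<Rightarrow> (int \<Rightarrow> int^2) \<Rightarrow> int^2" where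
  "digit_sum m M x = (\<Sum>p\<in>{m..M}. (R [^]\<^bsub>GL2Z\<^esub> (- p)) *v x p)"

text \<open>Read the word as a walk of the cursor from \<open>0\<close> to \<open>k\<close>, with \<open>m\<close> and \<open>M\<close> the extreme positions visited.
  A walk covering \<open>{m..M}\<close> crosses each of the \<open>\<bar>k\<bar>\<close> edges between its endpoints at least once and the other
  edges of the range at least twice, which accounts for \<open>2 * (M - m) - \<bar>k\<bar>\<close> moves; all other letters
  are spent on digits. The induction appends one letter at a time: a move that stays in the range
  changes \<open>\<bar>k\<bar>\<close> by one, and a move that enlarges the range also enlarges \<open>\<bar>k\<bar>\<close>, so that each
  costs at most one.\<close>

lemma digits_of_word:
  assumes "set ws \<subseteq> letters"
    and "word_prod (semidirect R) ws = (h, k)"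
  shows "\<exists>m M x. m \<le> 0 \<and> 0 \<le> M \<and> m \<le> k \<and> k \<le> M \<and> h = digit_sum m M x \<and>
    2 * (M - m) - \<bar>k\<bar> + (\<Sum>p\<in>{m..M}. l1 (x p)) \<le> int (length ws)"
  using assms
proof (induction ws arbitrary: h k rule: rev_induct)
  case Nil
  then show ?case
    by (intro exI[of _ 0] exI[of _ 0] exI[of _ "\<lambda>_. 0"])
      (auto simp: word_prod_def semidirect_one digit_sum_def l1_def)
next
  case (snoc l ws)
  obtain h0 k0 where hk0: "word_prod (semidirect R) ws = (h0, k0)" by (metis surj_pair)
  obtain m M x where mM: "m \<le> 0" "0 \<le> M" "m \<le> k0" "k0 \<le> M" and h0: "h0 = digit_sum m M x"
    and cost: "2 * (M - m) - \<bar>k0\<bar> + (\<Sum>p\<in>{m..M}. l1 (x p)) \<le> int (length ws)"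
    using snoc.IH[OF _ hk0] snoc.prems(1) by auto
  have "word_prod (semidirect R) (ws @ [l])
      = word_prod (semidirect R) ws \<otimes>\<^bsub>semidirect R\<^esub> word_prod (semidirect R) [l]"
    by (rule G.word_prod_append) auto
  then have hk: "(h, k) = (h0, k0) \<otimes>\<^bsub>semidirect R\<^esub> l"
    using snoc.prems(2) hk0 by (simp add: word_prod_def)
  have "(\<exists>y. l = (y, 0) \<and> l1 y = 1) \<or> l = (0, 1) \<or> l = (0, - 1)"
    using snoc.prems(1) by (auto simp: l1_def axis_def)
  then consider (digit) y where "l = (y, 0)" "l1 y = 1" | (up) "l = (0, 1)" | (down) "l = (0, - 1)"
    by blast
  then show ?case
  proof cases
    case digit
    define x' where "x' = x(k0 := x k0 + y)"
    have k: "k = k0" and h: "h = h0 + (R [^]\<^bsub>GL2Z\<^esub> (- k0)) *v y"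
      using hk digit by (auto simp: semidirect_mult)
    have rem: "{m..M} - {k0} \<subseteq> {m..M}" "k0 \<in> {m..M}" "finite {m..M}" using mM by auto
    have "digit_sum m M x' = (R [^]\<^bsub>GL2Z\<^esub> (- k0)) *v x' k0 + (\<Sum>p\<in>{m..M} - {k0}. (R [^]\<^bsub>GL2Z\<^esub> (- p)) *v x' p)"
      unfolding digit_sum_def by (rule sum.remove) (use rem in auto)
    also have "(\<Sum>p\<in>{m..M} - {k0}. (R [^]\<^bsub>GL2Z\<^esub> (- p)) *v x' p)
        = (\<Sum>p\<in>{m..M} - {k0}. (R [^]\<^bsub>GL2Z\<^esub> (- p)) *v x p)"
      by (rule sum.cong) (auto simp: x'_def)
    also have "(R [^]\<^bsub>GL2Z\<^esub> (- k0)) *v x' k0 + \<dots> = h"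
      unfolding h h0 digit_sum_def sum.remove[OF rem(3) rem(2), of "\<lambda>p. (R [^]\<^bsub>GL2Z\<^esub> (- p)) *v x p"]
      by (simp add: x'_def matrix_vector_right_distrib algebra_simps)
    finally have *: "h = digit_sum m M x'" by simp
    have "(\<Sum>p\<in>{m..M}. l1 (x' p)) = l1 (x' k0) + (\<Sum>p\<in>{m..M} - {k0}. l1 (x' p))"
      by (rule sum.remove) (use rem in auto)
    also have "(\<Sum>p\<in>{m..M} - {k0}. l1 (x' p)) = (\<Sum>p\<in>{m..M} - {k0}. l1 (x p))"
      by (rule sum.cong) (auto simp: x'_def)
    also have "l1 (x' k0) + \<dots> \<le> 1 + (\<Sum>p\<in>{m..M}. l1 (x p))"
      unfolding sum.remove[OF rem(3) rem(2), of "\<lambda>p. l1 (x p)"]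
      using l1_triangle[of "x k0" y] digit(2) by (simp add: x'_def)
    finally show ?thesis using mM * cost k
      by (intro exI[of _ m] exI[of _ M] exI[of _ x']) simp
  next
    case up
    have k: "k = k0 + 1" and h: "h = h0" using hk up by (auto simp: semidirect_mult)
    show ?thesis
    proof (cases "k \<le> M")
      case True
      then show ?thesis using mM k h h0 cost
        by (intro exI[of _ m] exI[of _ M] exI[of _ x]) auto
    next
      case False
      then have M: "M = k0" using mM k by simp
      \<comment> \<open>The digit function is arbitrary outside the old range, so the new position needs digit \<open>0\<close>.\<close>
      define x' where "x' = x(k := 0)"
      have ivl: "{m..k} = insert k {m..M}" "k \<notin> {m..M}" using M k mM by auto
      have "digit_sum m k x' = digit_sum m M x"
        unfolding digit_sum_def ivl(1) using ivl(2) by (auto simp: x'_def intro!: sum.cong)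
      moreover have "(\<Sum>p\<in>{m..k}. l1 (x' p)) = (\<Sum>p\<in>{m..M}. l1 (x p))"
        unfolding ivl(1) using ivl(2) by (auto simp: x'_def l1_def intro!: sum.cong)
      ultimately show ?thesis using mM k h h0 cost M
        by (intro exI[of _ m] exI[of _ k] exI[of _ x']) auto
    qed
  next
    case down
    have k: "k = k0 - 1" and h: "h = h0" using hk down by (auto simp: semidirect_mult)
    show ?thesis
    proof (cases "m \<le> k")
      case True
      then show ?thesis using mM k h h0 cost
        by (intro exI[of _ m] exI[of _ M] exI[of _ x]) auto
    next
      case False
      then have m: "m = k0" using mM k by simp
      define x' where "x' = x(k := 0)"
      have ivl: "{k..M} = insert k {m..M}" "k \<notin> {m..M}" using m k mM by auto
      have "digit_sum k M x' = digit_sum m M x"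
        unfolding digit_sum_def ivl(1) using ivl(2) by (auto simp: x'_def intro!: sum.cong)
      moreover have "(\<Sum>p\<in>{k..M}. l1 (x' p)) = (\<Sum>p\<in>{m..M}. l1 (x p))"
        unfolding ivl(1) using ivl(2) by (auto simp: x'_def l1_def intro!: sum.cong)
      ultimately show ?thesis using mM k h h0 cost m
        by (intro exI[of _ k] exI[of _ M] exI[of _ x']) auto
    qed
  qed
qed

lemma digits_of_element:
  obtains m M x where "m \<le> 0" "0 \<le> M" "m \<le> k" "k \<le> M" "h = digit_sum m M x"
    "2 * (M - m) - \<bar>k\<bar> + (\<Sum>p\<in>{m..M}. l1 (x p)) \<le> int (len R (h, k))"
proof -
  obtain ws where ws: "set ws \<subseteq> {gen_a, gen_b, gen_c} \<union> m_inv (semidirect R) ` {gen_a, gen_b, gen_c}"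
    "word_prod (semidirect R) ws = (h, k)" "length ws = len R (h, k)"
    using G.geodesic_word[OF generators, of "(h, k)"] by auto
  show thesis using digits_of_word[OF ws(1)[unfolded letters_eq] ws(2)] ws(3) that by auto
qed

lemma abs_le_len: "\<bar>k\<bar> \<le> int (len R (h, k))"
proof (rule digits_of_element[of k h])
  fix m M x
  assume *: "m \<le> 0" "0 \<le> M" "m \<le> k" "k \<le> M"
    "2 * (M - m) - \<bar>k\<bar> + (\<Sum>p\<in>{m..M}. l1 (x p)) \<le> int (len R (h, k))"
  have "0 \<le> (\<Sum>p\<in>{m..M}. l1 (x p))" by (rule sum_nonneg) (rule l1_nonneg)
  then have "2 * (M - m) - \<bar>k\<bar> \<le> int (len R (h, k))" using *(5) by linarith
  moreover have "\<bar>k\<bar> \<le> M - m" using *(1-4) by linarith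
  moreover have "a \<le> c" if "2 * b - a \<le> c" "a \<le> b" for a b c :: int using that by linarith
  ultimately show "\<bar>k\<bar> \<le> int (len R (h, k))" by blast
qed

text \<open>The word first walks from \<open>0\<close> to \<open>m\<close> and then sweeps upwards, writing each digit as it passes.\<close>

lemma len_sweep:
  "int (len R (digit_sum m (m + int n) x, m + int n)) \<le> \<bar>m\<bar> + int n + (\<Sum>p\<in>{m..m + int n}. l1 (x p))"
proof (induction n)
  case 0
  have "(0, m) \<otimes>\<^bsub>semidirect R\<^esub> (x m, 0) = (digit_sum m m x, m)"
    by (simp add: semidirect_mult digit_sum_def)
  then show ?case
    using len_mult[of "(0, m)" "(x m, 0)"] len_c_pow[of m] len_le_l1[of "x m"] by simp
next
  case (Suc n)
  let ?q = "m + int (Suc n)"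
  have ivl: "{m..?q} = insert ?q {m..m + int n}" "?q \<notin> {m..m + int n}" by auto
  have "(digit_sum m (m + int n) x, m + int n) \<otimes>\<^bsub>semidirect R\<^esub> (0, 1) \<otimes>\<^bsub>semidirect R\<^esub> (x ?q, 0)
      = (digit_sum m ?q x, ?q)"
    unfolding digit_sum_def ivl(1) sum.insert[OF finite_atLeastAtMost_int ivl(2)]
    by (simp add: semidirect_mult algebra_simps)
  moreover have "len R ((digit_sum m (m + int n) x, m + int n) \<otimes>\<^bsub>semidirect R\<^esub> (0, 1) \<otimes>\<^bsub>semidirect R\<^esub> (x ?q, 0))
      \<le> len R (digit_sum m (m + int n) x, m + int n) + 1 + len R (x ?q, 0)"
    by (intro len_mult_le order_refl len_letter) simp
  ultimately show ?case
    using Suc len_le_l1[of "x ?q"] unfolding ivl(1) sum.insert[OF finite_atLeastAtMost_int ivl(2)]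
    by simp
qed

text \<open>For \<open>0 \<le> k\<close> the sweep from \<open>m\<close> up to \<open>M\<close> is followed by a return from \<open>M\<close> to \<open>k\<close>; this order crosses
  the edges between \<open>0\<close> and \<open>k\<close> only once, hence the gain of \<open>\<bar>k\<bar>\<close>.\<close>

lemma len_digits_nonneg:
  assumes "m \<le> 0" "0 \<le> k" "k \<le> M"
  shows "int (len R (digit_sum m M x, k)) \<le> 2 * (M - m) - \<bar>k\<bar> + (\<Sum>p\<in>{m..M}. l1 (x p))"
proof -
  have "(digit_sum m M x, M) \<otimes>\<^bsub>semidirect R\<^esub> (0, k - M) = (digit_sum m M x, k)"
    by (simp add: semidirect_mult)
  then have "len R (digit_sum m M x, k) \<le> len R (digit_sum m M x, M) + len R (0, k - M)"
    using len_mult[of "(digit_sum m M x, M)" "(0, k - M)"] by simp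
  then show ?thesis
    using len_sweep[of m "nat (M - m)" x] len_c_pow[of "k - M"] assms by simp
qed

text \<open>Negative \<open>k\<close> reduces to positive \<open>k\<close> by inversion: the inverse of \<open>(h, k)\<close> is \<open>(- R\<^sup>k h, - k)\<close>, whose
  digits are those of \<open>h\<close>, negated and shifted by \<open>k\<close>.\<close>

lemma len_digits:
  assumes "m \<le> 0" "0 \<le> M" "m \<le> k" "k \<le> M"
  shows "int (len R (digit_sum m M x, k)) \<le> 2 * (M - m) - \<bar>k\<bar> + (\<Sum>p\<in>{m..M}. l1 (x p))"
proof (cases "0 \<le> k")
  case True
  then show ?thesis using len_digits_nonneg assms by blast
next
  case False
  define y where "y p = - x (p + k)" for p
  have bij: "bij_betw (\<lambda>p. p + k) {m - k..M - k} {m..M}"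
    by (rule bij_betw_byWitness[where f' = "\<lambda>p. p - k"]) auto
  have "(R [^]\<^bsub>GL2Z\<^esub> k) *v digit_sum m M x = (\<Sum>p\<in>{m..M}. (R [^]\<^bsub>GL2Z\<^esub> (k - p)) *v x p)"
    unfolding digit_sum_def matrix_vector_mult_sum
    by (rule sum.cong) (simp_all add: matrix_vector_mul_assoc flip: pow_add)
  also have "\<dots> = (\<Sum>p\<in>{m - k..M - k}. (R [^]\<^bsub>GL2Z\<^esub> (- p)) *v x (p + k))"
    by (subst sum.reindex_bij_betw[OF bij, symmetric]) simp
  also have "\<dots> = - digit_sum (m - k) (M - k) y"
    unfolding digit_sum_def y_def by (simp add: matrix_vector_mult_minus sum_negf)
  finally have "inv\<^bsub>semidirect R\<^esub> (digit_sum m M x, k) = (digit_sum (m - k) (M - k) y, - k)"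
    by (simp add: semidirect_inv)
  then have "inv\<^bsub>semidirect R\<^esub> (digit_sum (m - k) (M - k) y, - k) = (digit_sum m M x, k)"
    by (metis G.inv_inv UNIV_I semidirect_carrier)
  then have "len R (digit_sum m M x, k) \<le> len R (digit_sum (m - k) (M - k) y, - k)"
    by (metis G.word_length_inv_le[OF generators] UNIV_I semidirect_carrier)
  also have "int \<dots> \<le> 2 * ((M - k) - (m - k)) - \<bar>- k\<bar> + (\<Sum>p\<in>{m - k..M - k}. l1 (y p))"
    by (rule len_digits_nonneg) (use assms False in auto)
  also have "(\<Sum>p\<in>{m - k..M - k}. l1 (y p)) = (\<Sum>p\<in>{m..M}. l1 (x p))"
    by (subst sum.reindex_bij_betw[OF bij, symmetric]) (simp add: y_def)
  finally show ?thesis by simp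
qed


section \<open>Distortion of the lattice\<close>

text \<open>Write \<open>h = T q + r\<close>. The multiple \<open>T q\<close> is the sum of \<open>R\<^sup>2 q\<close> and \<open>R\<^sup>-\<^sup>2 q\<close>, so it costs about twice as
  much as \<open>q\<close>, while \<open>q\<close> is \<open>T \<ge> 3\<close> times shorter than \<open>h\<close>: the slope of a linear bound shrinks by
  the factor \<open>2/3\<close>.\<close>

lemma len_sublinear_step:
  fixes T :: int and \<epsilon> D :: real
  assumes T: "3 \<le> T"
    and trace: "\<And>h. (R [^]\<^bsub>GL2Z\<^esub> (2::int)) *v h + (R [^]\<^bsub>GL2Z\<^esub> (- 2::int)) *v h = T *s h"
    and bound: "\<And>h. real (len R (h, 0)) \<le> \<epsilon> * l1 h + D" and \<epsilon>: "0 \<le> \<epsilon>"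
  shows "real (len R (h, 0)) \<le> (2/3 * \<epsilon>) * l1 h + (4 * \<epsilon> + 2 * D + 8 + 2 * T)"
proof -
  define q :: "int^2" where "q = (\<chi> i. h $ i div T)"
  define r :: "int^2" where "r = (\<chi> i. h $ i mod T)"
  have h: "h = T *s q + r" by (simp add: q_def r_def vec_eq_iff)
  have r: "l1 r \<le> 2 * T"
  proof -
    have "0 \<le> r $ i \<and> r $ i < T" for i using T by (simp add: r_def)
    from this[of 1] this[of 2] show ?thesis by (simp add: l1_def)
  qed
  have comp: "T * \<bar>q $ i\<bar> \<le> \<bar>h $ i\<bar> + T" for i
  proof -
    have "h $ i = T * (q $ i) + r $ i" by (simp add: q_def r_def)
    moreover have "0 \<le> r $ i \<and> r $ i < T" using T by (simp add: r_def)
    ultimately have "\<bar>T * (q $ i)\<bar> \<le> \<bar>h $ i\<bar> + T" by linarith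
    then show ?thesis using T by (simp add: abs_mult)
  qed
  have q: "T * l1 q \<le> l1 h + 2 * T"
    using comp[of 1] comp[of 2] by (simp add: l1_def distrib_left)
  have lq: "3 * (l1 q - 2) \<le> l1 h"
  proof (cases "2 \<le> l1 q")
    case True
    then have "3 * (l1 q - 2) \<le> T * (l1 q - 2)" using T by (intro mult_right_mono) auto
    also have "\<dots> \<le> l1 h" using q by (simp add: algebra_simps)
    finally show ?thesis .
  next
    case False
    then have "3 * l1 q - 6 \<le> l1 h" using l1_nonneg[of h] by linarith
    then show ?thesis by simp
  qed
  have "len R (h, 0) \<le> len R ((R [^]\<^bsub>GL2Z\<^esub> (2::int)) *v q, 0) + len R ((R [^]\<^bsub>GL2Z\<^esub> (- 2::int)) *v q, 0) + len R (r, 0)"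
    using len_add[of "T *s q" r] len_add[of "(R [^]\<^bsub>GL2Z\<^esub> (2::int)) *v q" "(R [^]\<^bsub>GL2Z\<^esub> (- 2::int)) *v q"]
    unfolding h[symmetric] trace by linarith
  then have "int (len R (h, 0)) \<le> 2 * int (len R (q, 0)) + 8 + 2 * T"
    using len_pow[of 2 q] len_pow[of "- 2" q] len_le_l1[of r] r by linarith
  then have "real (len R (h, 0)) \<le> 2 * real (len R (q, 0)) + 8 + 2 * T"
    by linarith
  also have "\<dots> \<le> 2 * (\<epsilon> * l1 q + D) + 8 + 2 * T"
    using bound[of q] by simp
  also have "\<epsilon> * real_of_int (l1 q) \<le> \<epsilon> * (l1 h / 3 + 2)"
  proof (rule mult_left_mono[OF _ \<epsilon>])
    show "real_of_int (l1 q) \<le> l1 h / 3 + 2" using lq by (simp add: algebra_simps)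
  qed
  finally show ?thesis by (simp add: algebra_simps)
qed

lemma len_sublinear:
  fixes T :: int and \<epsilon> :: real
  assumes T: "3 \<le> T"
    and trace: "\<And>h. (R [^]\<^bsub>GL2Z\<^esub> (2::int)) *v h + (R [^]\<^bsub>GL2Z\<^esub> (- 2::int)) *v h = T *s h"
    and \<epsilon>: "0 < \<epsilon>"
  shows "\<exists>D. \<forall>h. real (len R (h, 0)) \<le> \<epsilon> * l1 h + D"
proof -
  have iter: "\<exists>D. \<forall>h. real (len R (h, 0)) \<le> (2/3) ^ i * l1 h + D" for i
  proof (induction i)
    case 0
    have "real (len R (h, 0)) \<le> l1 h" for h
      using len_le_l1[of h] by linarith
    then show ?case by (intro exI[of _ 0]) simp
  next
    case (Suc i)
    then obtain D where "\<And>h. real (len R (h, 0)) \<le> (2/3) ^ i * l1 h + D" by blast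
    from len_sublinear_step[OF T trace this] show ?case by force
  qed
  obtain i where i: "(2/3) ^ i < \<epsilon>" using real_arch_pow_inv[OF \<epsilon>, of "2/3"] by auto
  obtain D where D: "\<And>h. real (len R (h, 0)) \<le> (2/3) ^ i * l1 h + D" using iter by blast
  have "real (len R (h, 0)) \<le> \<epsilon> * l1 h + D" for h
  proof -
    have "(2/3) ^ i * real_of_int (l1 h) \<le> \<epsilon> * l1 h" using i by (intro mult_right_mono) (auto simp: l1_nonneg)
    then show ?thesis using D[of h] by linarith
  qed
  then show ?thesis by blast
qed

section \<open>Eigenfunctionals\<close>

lemma eigenfunctional_pow:
  fixes \<phi> :: "int^2 \<Rightarrow> real" and j :: int
  assumes "\<And>h. \<phi> (R *v h) = \<mu> * \<phi> h" "\<mu> \<noteq> 0"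
  shows "\<phi> ((R [^]\<^bsub>GL2Z\<^esub> j) *v h) = \<mu> powi j * \<phi> h"
proof -
  have R1: "R [^]\<^bsub>GL2Z\<^esub> (1::int) = R"
    using group.int_pow_1[OF group_GL2Z R] .
  have step: "\<phi> ((R [^]\<^bsub>GL2Z\<^esub> (i + 1)) *v h) = \<mu> * \<phi> ((R [^]\<^bsub>GL2Z\<^esub> i) *v h)" for i :: int
    using pow_add[of 1 i] assms(1) by (simp add: R1 add.commute flip: matrix_vector_mul_assoc)
  show ?thesis
  proof (induction j rule: int_induct[where k = 0])
    case base
    then show ?case by simp
  next
    case (step1 i)
    then show ?case using step[of i] assms(2) power_int_add_1[of \<mu> i] by simp
  next
    case (step2 i)
    have "\<mu> * \<phi> ((R [^]\<^bsub>GL2Z\<^esub> (i - 1)) *v h) = \<mu> * (\<mu> powi (i - 1) * \<phi> h)"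
      using step[of "i - 1"] step2 assms(2) power_int_add_1[of \<mu> "i - 1"] by (simp add: algebra_simps)
    then show ?case using assms(2) by simp
  qed
qed

text \<open>A digit at \<open>p\<close> contributes to an eigencoordinate with weight \<open>\<mu>\<^sup>-\<^sup>p\<close>. If the range of positions keeps
  these weights bounded, the eigencoordinate is at most proportional to the total of the digits.\<close>

lemma eigenfunctional_digit_sum:
  fixes \<phi> :: "int^2 \<Rightarrow> real" and C \<Lambda> :: real
  assumes "\<And>h. \<phi> (R *v h) = \<mu> * \<phi> h" "\<mu> \<noteq> 0"
    and add: "\<And>x y. \<phi> (x + y) = \<phi> x + \<phi> y"
    and C: "\<And>x. \<bar>\<phi> x\<bar> \<le> C * l1 x" "0 \<le> C"
    and \<Lambda>: "\<And>p. p \<in> {m..M} \<Longrightarrow> \<bar>\<mu> powi (- p)\<bar> \<le> \<Lambda>"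
  shows "\<bar>\<phi> (digit_sum m M x)\<bar> \<le> \<Lambda> * C * (\<Sum>p\<in>{m..M}. l1 (x p))"
proof -
  have zero: "\<phi> 0 = 0" using add[of 0 0] by simp
  have "\<phi> (digit_sum m M x) = (\<Sum>p\<in>{m..M}. \<phi> ((R [^]\<^bsub>GL2Z\<^esub> (- p)) *v x p))"
    unfolding digit_sum_def
    by (induction rule: finite_induct[OF finite_atLeastAtMost_int[of m M]]) (simp_all add: zero add)
  also have "\<bar>\<dots>\<bar> \<le> (\<Sum>p\<in>{m..M}. \<bar>\<phi> ((R [^]\<^bsub>GL2Z\<^esub> (- p)) *v x p)\<bar>)"
    by (rule sum_abs)
  also have "\<dots> \<le> (\<Sum>p\<in>{m..M}. \<Lambda> * (C * l1 (x p)))"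
  proof (rule sum_mono)
    fix p assume p: "p \<in> {m..M}"
    have "\<bar>\<phi> ((R [^]\<^bsub>GL2Z\<^esub> (- p)) *v x p)\<bar> = \<bar>\<mu> powi (- p)\<bar> * \<bar>\<phi> (x p)\<bar>"
      using eigenfunctional_pow[of \<phi> \<mu> "- p" "x p"] assms(1,2) by (simp add: abs_mult)
    also have "\<dots> \<le> \<Lambda> * (C * l1 (x p))"
      using order_trans[OF abs_ge_zero \<Lambda>[OF p]] \<Lambda>[OF p] C by (intro mult_mono) auto
    finally show "\<bar>\<phi> ((R [^]\<^bsub>GL2Z\<^esub> (- p)) *v x p)\<bar> \<le> \<Lambda> * (C * l1 (x p))" .
  qed
  also have "\<dots> = \<Lambda> * C * (\<Sum>p\<in>{m..M}. l1 (x p))"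
    by (simp add: sum_distrib_left mult.assoc)
  finally show ?thesis .
qed

text \<open>The weights \<open>\<sigma>\<^sup>-\<^sup>p\<close> are bounded on \<open>p < K\<close> and the weights \<open>\<tau>\<^sup>-\<^sup>p\<close> on \<open>p > - K\<close>. If both
  eigencoordinates of \<open>h\<close> are large compared with its length, the cursor of a shortest word for \<open>(h, 0)\<close>
  must therefore reach both \<open>K\<close> and \<open>- K\<close>, and the same digits can be written by a word ending at \<open>k\<close>.\<close>

lemma len_move_cursor:
  fixes \<phi> \<psi> :: "int^2 \<Rightarrow> real" and C \<Lambda> :: real
  assumes \<phi>: "\<And>h. \<phi> (R *v h) = \<sigma> * \<phi> h" "\<And>x y. \<phi> (x + y) = \<phi> x + \<phi> y" "\<And>x. \<bar>\<phi> x\<bar> \<le> C * l1 x"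
    and \<psi>: "\<And>h. \<psi> (R *v h) = \<tau> * \<psi> h" "\<And>x y. \<psi> (x + y) = \<psi> x + \<psi> y" "\<And>x. \<bar>\<psi> x\<bar> \<le> C * l1 x"
    and \<sigma>: "\<sigma> \<noteq> 0" "\<bar>\<sigma>\<bar> < 1" and \<tau>: "1 < \<bar>\<tau>\<bar>" and C: "0 \<le> C"
    and \<Lambda>: "\<bar>\<sigma>\<bar> powi (- K) \<le> \<Lambda>" "\<bar>\<tau>\<bar> powi K \<le> \<Lambda>"
    and far: "\<Lambda> * C * len R (h, 0) < \<bar>\<phi> h\<bar>" "\<Lambda> * C * len R (h, 0) < \<bar>\<psi> h\<bar>"
    and k: "\<bar>k\<bar> \<le> K"
  shows "len R (h, k) \<le> len R (h, 0)"
proof -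
  obtain m M x where mM: "m \<le> 0" "0 \<le> M" "h = digit_sum m M x"
    and cost: "2 * (M - m) - \<bar>0\<bar> + (\<Sum>p\<in>{m..M}. l1 (x p)) \<le> int (len R (h, 0))"
    by (rule digits_of_element[of 0 h])
  have "(\<Sum>p\<in>{m..M}. l1 (x p)) \<le> int (len R (h, 0))" using mM(1,2) cost by simp
  then have sum_le: "real_of_int (\<Sum>p\<in>{m..M}. l1 (x p)) \<le> len R (h, 0)"
    by (metis of_int_le_iff of_int_of_nat_eq)
  have "0 \<le> \<bar>\<tau>\<bar> powi K" by simp
  then have \<Lambda>0: "0 \<le> \<Lambda>" using \<Lambda>(2) by linarith
  have bound: "\<Lambda> * C * (\<Sum>p\<in>{m..M}. l1 (x p)) \<le> \<Lambda> * C * len R (h, 0)"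
    using sum_le \<Lambda>0 C by (intro mult_left_mono) auto
  have "K \<le> M"
  proof (rule ccontr)
    assume "\<not> K \<le> M"
    then have *: "\<bar>\<sigma> powi (- p)\<bar> \<le> \<Lambda>" if "p \<in> {m..M}" for p
      using that power_int_decreasing[of "- K" "- p" "\<bar>\<sigma>\<bar>"] \<sigma> \<Lambda>(1)
      by (simp add: power_int_abs)
    have "\<bar>\<phi> h\<bar> \<le> \<Lambda> * C * (\<Sum>p\<in>{m..M}. l1 (x p))"
      unfolding mM(3) by (rule eigenfunctional_digit_sum[OF \<phi>(1) \<sigma>(1) \<phi>(2,3) C]) (rule *)
    then show False using far(1) bound by linarith
  qed
  moreover have "m \<le> - K"
  proof (rule ccontr)
    assume "\<not> m \<le> - K"
    then have *: "\<bar>\<tau> powi (- p)\<bar> \<le> \<Lambda>" if "p \<in> {m..M}" for p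
      using that power_int_increasing[of "- p" K "\<bar>\<tau>\<bar>"] \<tau> \<Lambda>(2)
      by (simp add: power_int_abs)
    have "\<tau> \<noteq> 0" using \<tau> by auto
    have "\<bar>\<psi> h\<bar> \<le> \<Lambda> * C * (\<Sum>p\<in>{m..M}. l1 (x p))"
      unfolding mM(3) by (rule eigenfunctional_digit_sum[OF \<psi>(1) \<open>\<tau> \<noteq> 0\<close> \<psi>(2,3) C]) (rule *)
    then show False using far(2) bound by linarith
  qed
  ultimately have "int (len R (h, k)) \<le> 2 * (M - m) - \<bar>k\<bar> + (\<Sum>p\<in>{m..M}. l1 (x p))"
    unfolding mM(3) using mM(1,2) k by (intro len_digits) auto
  moreover have "2 * (M - m) + (\<Sum>p\<in>{m..M}. l1 (x p)) \<le> int (len R (h, 0))" using cost by simp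
  moreover have "0 \<le> \<bar>k\<bar>" by simp
  ultimately have "int (len R (h, k)) \<le> int (len R (h, 0))" by linarith
  then show ?thesis by simp
qed

end

section \<open>Hyperbolic integer matrices\<close>

lemma invertible_det:
  fixes R :: "int^2^2"
  assumes "invertible R"
  shows "det R = 1 \<or> det R = - 1"
proof -
  obtain R' where "R ** R' = mat 1" using assms unfolding invertible_def by blast
  then have "det R * det R' = 1" by (metis det_I det_mul)
  then show ?thesis using zmult_eq_1_iff by blast
qed

lemma complex_eigenvalueI:
  fixes R :: "int^2^2" and l :: complex
  assumes "l\<^sup>2 - of_int (R $ 1 $ 1 + R $ 2 $ 2) * l + of_int (det R) = 0"
  shows "complex_eigenvalue R l"
proof -
  \<comment> \<open>A nonzero row of \<open>R - l\<close> is orthogonal to an eigenvector; if both rows vanish, every vector is one.\<close>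
  let ?p = "of_int (R $ 1 $ 1) :: complex" and ?q = "of_int (R $ 1 $ 2) :: complex"
  let ?r = "of_int (R $ 2 $ 1) :: complex" and ?s = "of_int (R $ 2 $ 2) :: complex"
  have eq: "(l - ?p) * (l - ?s) = ?q * ?r"
    using assms by (simp add: det_2 power2_eq_square algebra_simps)
  have *: "complex_eigenvalue R l" if "v \<noteq> 0 \<or> w \<noteq> 0" "?p * v + ?q * w = l * v" "?r * v + ?s * w = l * w" for v w
    unfolding complex_eigenvalue_def using that
    by (intro exI[of _ "\<chi> i. if i = 1 then v else w"])
      (auto simp: vec_eq_iff forall_2 matrix_vector_mult_def sum_2 map_matrix_def)
  show ?thesis
  proof (cases "?q = 0 \<and> l = ?p")
    case False
    show ?thesis
      by (rule *[of ?q "l - ?p"]) (use False eq in \<open>auto simp: algebra_simps\<close>)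
  next
    case True
    show ?thesis
    proof (cases "?r = 0 \<and> l = ?s")
      case False
      show ?thesis
        by (rule *[of "l - ?s" ?r]) (use True False eq in \<open>auto simp: algebra_simps\<close>)
    next
      case rs: True
      show ?thesis by (rule *[of 1 0]) (use True rs in auto)
    qed
  qed
qed

text \<open>Among the integer pairs \<open>(t, d)\<close> with \<open>d = \<plusminus>1\<close>, the roots of \<open>X\<^sup>2 - t X + d\<close> avoid the unit circle only
  if \<open>\<bar>t\<bar> \<ge> 3\<close> for \<open>d = 1\<close>, and \<open>t \<noteq> 0\<close> for \<open>d = - 1\<close>. In both cases the discriminant is positive, so the roots
  are real, and the trace \<open>t\<^sup>2 - 2 d\<close> of \<open>R\<^sup>2\<close> is at least \<open>3\<close>. The corner entry is nonzero because a triangular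
  matrix in \<open>GL\<^sub>2(\<int>)\<close> has eigenvalues \<open>\<plusminus>1\<close>.\<close>

lemma hyperbolic_spectrum:
  fixes R :: "int^2^2"
  assumes "hyperbolic R"
  defines "t \<equiv> R $ 1 $ 1 + R $ 2 $ 2" and "d \<equiv> det R"
  obtains \<sigma> \<tau> :: real where "\<sigma>\<^sup>2 - t * \<sigma> + d = 0" "\<tau>\<^sup>2 - t * \<tau> + d = 0"
    "\<bar>\<sigma>\<bar> < 1" "1 < \<bar>\<tau>\<bar>" "\<sigma> \<noteq> 0" "R $ 2 $ 1 \<noteq> 0" "3 \<le> t\<^sup>2 - 2 * d"
proof -
  have d: "d = 1 \<or> d = - 1"
    using assms invertible_det unfolding hyperbolic_def GL2Z_def by auto
  have no_root: "cmod l \<noteq> 1" if "l\<^sup>2 - of_int t * l + of_int d = 0" for l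
    using assms(1) complex_eigenvalueI[of l R] that unfolding hyperbolic_def t_def d_def by blast
  have no_real: "\<bar>x\<bar> \<noteq> 1" if "x\<^sup>2 - t * x + d = 0" for x :: real
  proof -
    have "complex_of_real (x\<^sup>2 - t * x + d) = 0" using that by simp
    then have "(complex_of_real x)\<^sup>2 - of_int t * of_real x + of_int d = 0" by simp
    from no_root[OF this] show ?thesis by simp
  qed
  have disc: "0 < t\<^sup>2 - 4 * d \<and> 3 \<le> t\<^sup>2 - 2 * d"
  proof (cases "d = 1")
    case True
    have "\<not> \<bar>t\<bar> \<le> 2"
    proof
      assume "\<bar>t\<bar> \<le> 2"
      then have "t\<^sup>2 \<le> 2\<^sup>2" by (metis abs_le_square_iff abs_numeral)
      then have "(real_of_int t)\<^sup>2 \<le> 4" using of_int_le_iff[of "t\<^sup>2" 4] by simp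
      then have sq: "(sqrt (4 - (real_of_int t)\<^sup>2))\<^sup>2 = 4 - (real_of_int t)\<^sup>2" by simp
      define l where "l = Complex (t / 2) (sqrt (4 - (real_of_int t)\<^sup>2) / 2)"
      have "(cmod l)\<^sup>2 = 1" unfolding l_def cmod_power2 using sq by (simp add: power_divide field_simps)
      then have "cmod l = 1" by (simp add: power2_eq_1_iff) (use norm_ge_zero[of l] in linarith)
      moreover have "l\<^sup>2 - of_int t * l + of_int d = 0"
        using sq True by (simp add: l_def complex_eq_iff power2_eq_square field_simps)
      ultimately show False using no_root by blast
    qed
    then have "3\<^sup>2 \<le> t\<^sup>2" unfolding abs_le_square_iff[symmetric] by simp
    then show ?thesis using True by simp
  next
    case False
    then have d: "d = - 1" using d by simp
    have "t \<noteq> 0"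
    proof
      assume "t = 0"
      then have "\<bar>1::real\<bar> \<noteq> 1" by (intro no_real) (simp add: d)
      then show False by simp
    qed
    then have "1\<^sup>2 \<le> t\<^sup>2" unfolding abs_le_square_iff[symmetric] by simp
    then show ?thesis using d by simp
  qed
  have r: "R $ 2 $ 1 \<noteq> 0"
  proof
    assume "R $ 2 $ 1 = 0"
    then have ps: "R $ 1 $ 1 * R $ 2 $ 2 = d" unfolding d_def by (simp add: det_2)
    have "(real_of_int (R $ 1 $ 1))\<^sup>2 - t * real_of_int (R $ 1 $ 1) + d = 0"
      unfolding ps[symmetric] t_def by (simp add: power2_eq_square algebra_simps)
    from no_real[OF this] have "\<bar>R $ 1 $ 1\<bar> \<noteq> 1" by linarith
    moreover have "\<bar>R $ 1 $ 1\<bar> = 1" using ps d zmult_eq_1_iff[of "R $ 1 $ 1" "R $ 2 $ 2"]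
      zmult_eq_1_iff[of "R $ 1 $ 1" "- R $ 2 $ 2"] by auto
    ultimately show False by simp
  qed
  define D where "D = sqrt (real_of_int (t\<^sup>2 - 4 * d))"
  have D2: "D\<^sup>2 = (real_of_int t)\<^sup>2 - 4 * real_of_int d"
  proof -
    have "0 \<le> real_of_int (t\<^sup>2 - 4 * d)" unfolding of_int_0_le_iff using disc by simp
    then show ?thesis unfolding D_def by simp
  qed
  define x y where "x = (t + D) / 2" and "y = (t - D) / 2"
  have x: "x\<^sup>2 - t * x + d = 0" and y: "y\<^sup>2 - t * y + d = 0" and xy: "x * y = d"
    using D2 by (simp_all add: x_def y_def power2_eq_square field_simps)
  have xy1: "\<bar>x\<bar> * \<bar>y\<bar> = 1" using xy d by (auto simp flip: abs_mult)
  then have xy0: "x \<noteq> 0" "y \<noteq> 0" by auto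
  show thesis
  proof (cases "\<bar>x\<bar> < 1")
    case True
    have "1 < \<bar>y\<bar>"
    proof (rule ccontr)
      assume "\<not> 1 < \<bar>y\<bar>"
      then have "\<bar>x\<bar> * \<bar>y\<bar> \<le> \<bar>x\<bar>" by (intro mult_right_le_one_le) auto
      then show False using True xy1 by simp
    qed
    then show thesis using that[of x y] x y True xy0 r disc by blast
  next
    case False
    then have x1: "1 < \<bar>x\<bar>" using no_real[OF x] by simp
    have "\<bar>y\<bar> < 1"
    proof (rule ccontr)
      assume "\<not> \<bar>y\<bar> < 1"
      then have "\<bar>x\<bar> \<le> \<bar>x\<bar> * \<bar>y\<bar>" by (simp add: mult_le_cancel_left1)
      then show False using x1 xy1 by simp
    qed
    then show thesis using that[of y x] x y x1 xy0 r disc by blast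
  qed
qed

lemma matrix_vector_2:
  fixes M :: "int^2^2"
  shows "(M *v h) $ 1 = M $ 1 $ 1 * h $ 1 + M $ 1 $ 2 * h $ 2"
    and "(M *v h) $ 2 = M $ 2 $ 1 * h $ 1 + M $ 2 $ 2 * h $ 2"
  by (simp_all add: matrix_vector_mult_def sum_2)

text \<open>Cayley--Hamilton for \<open>R\<^sup>2\<close>, whose determinant is \<open>1\<close> and whose trace is \<open>t\<^sup>2 - 2 d\<close>. Taking \<open>R\<^sup>2\<close> instead
  of \<open>R\<close> disposes of the sign of the determinant and of the traces \<open>\<plusminus>1\<close>. It is derived from the
  recurrence for the powers of \<open>R\<close> applied to \<open>h\<close>.\<close>

lemma trace_square:
  fixes R :: "int^2^2"
  assumes R: "R \<in> carrier GL2Z"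
  shows "(R [^]\<^bsub>GL2Z\<^esub> (2::int)) *v h + (R [^]\<^bsub>GL2Z\<^esub> (- 2::int)) *v h
    = ((R $ 1 $ 1 + R $ 2 $ 2)\<^sup>2 - 2 * det R) *s h"
proof -
  define t d where "t = R $ 1 $ 1 + R $ 2 $ 2" and "d = det R"
  have "d = 1 \<or> d = - 1" using R invertible_det unfolding d_def GL2Z_def by auto
  then have dd: "d * d = 1" by auto
  define g where "g j = (R [^]\<^bsub>GL2Z\<^esub> (j::int)) *v h" for j
  have R1: "R [^]\<^bsub>GL2Z\<^esub> (1::int) = R" using group.int_pow_1[OF group_GL2Z R] .
  have g: "g (j + 1) = R *v g j" for j
    using GL2Z_pow_add[OF R, of 1 j] by (simp add: g_def R1 add.commute flip: matrix_vector_mul_assoc)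
  have ch: "R *v (R *v x) = t *s (R *v x) - d *s x" for x
    by (simp add: vec_eq_iff forall_2 matrix_vector_2 t_def d_def det_2 algebra_simps)
  have rec: "g (j + 2) = t *s g (j + 1) - d *s g j" for j
    using ch[of "g j"] g[of j] g[of "j + 1"] by (simp add: add.assoc)
  have rec': "g (j + 2) $ i = t * g (j + 1) $ i - d * g j $ i" for i j
    by (simp add: rec)
  have g0: "g 0 = h" by (simp add: g_def)
  have "g 2 $ i + g (- 2) $ i = (t\<^sup>2 - 2 * d) * h $ i" for i
  proof -
    have 1: "g 2 $ i = t * g 1 $ i - d * h $ i" using rec'[of 0 i] by (simp add: g0)
    have 2: "g 1 $ i = t * h $ i - d * g (- 1) $ i" using rec'[of "- 1" i] by (simp add: g0)
    have 3: "h $ i = t * g (- 1) $ i - d * g (- 2) $ i" using rec'[of "- 2" i] by (simp add: g0)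
    have "g (- 2) $ i = d * (d * g (- 2) $ i)" using dd by (simp flip: mult.assoc)
    also have "\<dots> = d * (t * g (- 1) $ i - h $ i)" using 3 by simp
    also have "\<dots> = t * (d * g (- 1) $ i) - d * h $ i" by (simp add: algebra_simps)
    also have "d * g (- 1) $ i = t * h $ i - g 1 $ i" using 2 by simp
    finally show ?thesis using 1 by (simp add: power2_eq_square algebra_simps)
  qed
  then show ?thesis unfolding g_def t_def d_def vec_eq_iff by (simp only: vector_add_component vector_smult_component) simp
qed

section \<open>Deep pockets\<close>

text \<open>Maximise \<open>W * f h - l1 (h - h0)\<close>: the penalty is dominant by the growth bound. Moving by less than \<open>W\<close>
  changes it by less than \<open>W\<close>, so at a maximum \<open>W * f\<close> grows by less than \<open>W\<close>, and the integer \<open>f\<close>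
  does not grow at all.\<close>

lemma penalised_maximum:
  fixes f :: "int^2 \<Rightarrow> nat" and W :: nat and \<epsilon> D :: real
  assumes growth: "\<And>h. real (f h) \<le> \<epsilon> * l1 h + D" and W: "W * \<epsilon> \<le> 1"
  obtains h where "l1 (h - h0) \<le> int W * int (f h)"
    "\<And>s. l1 s < int W \<Longrightarrow> f (h + s) \<le> f h"
proof -
  define \<Phi> where "\<Phi> h = int W * int (f h) - l1 (h - h0)" for h
  define B where "B = \<lceil>W * D + l1 h0\<rceil>"
  have B: "\<Phi> h \<le> B" for h
  proof -
    have "real W * real (f h) \<le> real W * (\<epsilon> * l1 h + D)"
      using growth[of h] by (intro mult_left_mono) auto
    also have "\<dots> = (real W * \<epsilon>) * l1 h + W * D" by (simp add: algebra_simps)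
    also have "\<dots> \<le> 1 * real_of_int (l1 h) + W * D" using W by (intro add_right_mono mult_right_mono) (auto simp: l1_nonneg)
    finally have "real W * real (f h) \<le> l1 h + W * D" by simp
    moreover have "l1 h \<le> l1 (h - h0) + l1 h0" using l1_triangle[of "h - h0" h0] by simp
    ultimately have "real_of_int (\<Phi> h) \<le> W * D + l1 h0" by (simp add: \<Phi>_def)
    then show ?thesis unfolding B_def by linarith
  qed
  obtain h where h: "\<And>h'. nat (B - \<Phi> h) \<le> nat (B - \<Phi> h')"
    using ex_has_least_nat[of "\<lambda>_. True" h0 "\<lambda>h. nat (B - \<Phi> h)"] by auto
  have max: "\<Phi> h' \<le> \<Phi> h" for h'
    using h[of h'] B[of h] B[of h'] by linarith
  show thesis
  proof (rule that)
    have "0 \<le> \<Phi> h0" by (simp add: \<Phi>_def l1_def)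
    then show "l1 (h - h0) \<le> int W * int (f h)" using max[of h0] by (simp add: \<Phi>_def)
  next
    fix s assume s: "l1 s < int W"
    have "l1 (h + s - h0) \<le> l1 (h - h0) + l1 s" using l1_triangle[of "h - h0" s] by (simp add: algebra_simps)
    then have "int W * int (f (h + s)) < int W * (int (f h) + 1)"
      using max[of "h + s"] s by (simp add: \<Phi>_def algebra_simps)
    then show "f (h + s) \<le> f h" by (simp add: mult_less_cancel_left)
  qed
qed

lemma deep_element:
  fixes R :: "int^2^2" and n :: nat
  assumes hyp: "hyperbolic R"
  obtains h where "n < depth (semidirect R) {gen_a, gen_b, gen_c} (h, 0)"
proof -
  have R: "R \<in> carrier GL2Z" using hyp by (simp add: hyperbolic_def)
  interpret G: group "semidirect R" by (rule group_semidirect[OF R])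
  define t d where "t = R $ 1 $ 1 + R $ 2 $ 2" and "d = det R"
  obtain \<sigma> \<tau> :: real where root: "\<sigma>\<^sup>2 - t * \<sigma> + d = 0" "\<tau>\<^sup>2 - t * \<tau> + d = 0"
    and \<sigma>: "\<bar>\<sigma>\<bar> < 1" "\<sigma> \<noteq> 0" and \<tau>: "1 < \<bar>\<tau>\<bar>" and r: "R $ 2 $ 1 \<noteq> 0" and T: "3 \<le> t\<^sup>2 - 2 * d"
    using hyperbolic_spectrum[OF hyp] unfolding t_def d_def by metis
  \<comment> \<open>\<open>\<phi> \<mu>\<close> is the row vector \<open>(R\<^sub>2\<^sub>1, \<mu> - R\<^sub>1\<^sub>1)\<close>, a left eigenvector of \<open>R\<close> for the eigenvalue \<open>\<mu>\<close>.\<close>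
  define \<phi> where "\<phi> \<mu> h = of_int (R $ 2 $ 1) * of_int (h $ 1) + (\<mu> - of_int (R $ 1 $ 1)) * of_int (h $ 2)"
    for \<mu> :: real and h :: "int^2"
  have eigen: "\<phi> \<mu> (R *v h) = \<mu> * \<phi> \<mu> h" if "\<mu>\<^sup>2 - t * \<mu> + d = 0" for \<mu> :: real and h
  proof -
    have "\<phi> \<mu> (R *v h) - \<mu> * \<phi> \<mu> h = - (\<mu>\<^sup>2 - t * \<mu> + d) * of_int (h $ 2)"
      by (simp add: \<phi>_def matrix_vector_2 t_def d_def det_2 power2_eq_square algebra_simps)
    then show ?thesis using that by simp
  qed
  have add: "\<phi> \<mu> (x + y) = \<phi> \<mu> x + \<phi> \<mu> y" for \<mu> x y
    by (simp add: \<phi>_def algebra_simps)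
  define C where "C = \<bar>real_of_int (R $ 2 $ 1)\<bar> + \<bar>\<sigma> - of_int (R $ 1 $ 1)\<bar> + \<bar>\<tau> - of_int (R $ 1 $ 1)\<bar>"
  have C0: "0 \<le> C" by (simp add: C_def)
  have C: "\<bar>\<phi> \<mu> x\<bar> \<le> C * l1 x" if "\<mu> = \<sigma> \<or> \<mu> = \<tau>" for \<mu> x
  proof -
    have "\<bar>\<phi> \<mu> x\<bar> \<le> \<bar>real_of_int (R $ 2 $ 1)\<bar> * \<bar>real_of_int (x $ 1)\<bar> + \<bar>\<mu> - of_int (R $ 1 $ 1)\<bar> * \<bar>real_of_int (x $ 2)\<bar>"
      unfolding \<phi>_def abs_mult[symmetric] by (rule abs_triangle_ineq)
    also have "\<dots> \<le> C * \<bar>real_of_int (x $ 1)\<bar> + C * \<bar>real_of_int (x $ 2)\<bar>"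
      using that by (intro add_mono mult_right_mono) (auto simp: C_def)
    finally show ?thesis by (simp add: l1_def algebra_simps)
  qed
  define \<Lambda> where "\<Lambda> = max (\<bar>\<sigma>\<bar> powi (- int n)) (\<bar>\<tau>\<bar> powi (int n))"
  have \<Lambda>0: "0 \<le> \<Lambda>" by (simp add: \<Lambda>_def le_max_iff_disj)

  \<comment> \<open>\<open>W\<close> exceeds the lattice displacement of every element of length at most \<open>n\<close>.\<close>
  have "finite ((\<lambda>g. nat (l1 (fst g))) ` {g \<in> carrier (semidirect R). len R g \<le> n})"
    by (intro finite_imageI G.finite_word_length_le[OF generators[OF R]]) simp
  then obtain W0 where "\<forall>w \<in> (\<lambda>g. nat (l1 (fst g))) ` {g \<in> carrier (semidirect R). len R g \<le> n}. w \<le> W0"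
    unfolding finite_nat_set_iff_bounded_le by blast
  then have W0: "nat (l1 s) \<le> W0" if "len R (s, k) \<le> n" for s k
    using that by (force simp: image_iff)
  define W where "W = Suc W0"
  have W: "l1 s < int W" if "len R (s, k) \<le> n" for s k
    using W0[OF that] by (simp add: W_def)

  \<comment> \<open>The eigencoordinates of the points \<open>h + s\<close> below are at least \<open>N - C W (f h + 1)\<close> and should exceed
      \<open>\<Lambda> C (f h)\<close>, so \<open>P * f h + C * W < N\<close> is wanted. As \<open>f h \<le> 2 \<epsilon> N + 2 D\<close>, it is enough that \<open>4 P \<epsilon> \<le> 1\<close> and
      that \<open>N\<close> is large; \<open>2 W \<epsilon> \<le> 1\<close> is what gives this bound on \<open>f h\<close>.\<close>
  define P where "P = \<Lambda> * C + C * W"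
  have P0: "0 \<le> P" using \<Lambda>0 C0 by (simp add: P_def)
  define \<epsilon> where "\<epsilon> = 1 / (2 * real W + 4 * P)"
  have den: "0 < 2 * real W + 4 * P" using P0 by (simp add: W_def)
  then have \<epsilon>: "0 < \<epsilon>" "2 * W * \<epsilon> \<le> 1" "4 * P * \<epsilon> \<le> 1"
    using P0 by (simp_all add: \<epsilon>_def)
  obtain D where D: "\<And>h. real (len R (h, 0)) \<le> \<epsilon> * l1 h + D"
    using len_sublinear[OF R T _ \<epsilon>(1)] trace_square[OF R] unfolding t_def d_def by blast

  obtain N :: nat where N: "4 * P * D + 2 * C * W < N" using reals_Archimedean2 by blast
  define h0 :: "int^2" where "h0 = int N *s axis 1 1"
  have l1_h0: "l1 h0 = int N" by (simp add: h0_def l1_def axis_def)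
  have \<phi>_h0: "real N \<le> \<bar>\<phi> \<mu> h0\<bar>" for \<mu>
  proof -
    have "1 \<le> \<bar>real_of_int (R $ 2 $ 1)\<bar>" using r by linarith
    then have "1 * real N \<le> \<bar>real_of_int (R $ 2 $ 1)\<bar> * real N" by (intro mult_right_mono) auto
    then show ?thesis by (simp add: \<phi>_def h0_def axis_def abs_mult)
  qed
  have "W * \<epsilon> \<le> 1" using \<epsilon>(1,2) by (simp add: mult.assoc)
  then obtain h where near_h0: "l1 (h - h0) \<le> int W * int (len R (h, 0))"
    and max: "\<And>s. l1 s < int W \<Longrightarrow> len R (h + s, 0) \<le> len R (h, 0)"
    using penalised_maximum[OF D, of W h0] by blast
  let ?f = "real (len R (h, 0))"
  have near: "real_of_int (l1 (h - h0)) \<le> W * ?f"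
    using near_h0 by (metis of_int_le_iff of_int_mult of_int_of_nat_eq)
  have "l1 h \<le> l1 (h - h0) + int N" using l1_triangle[of "h - h0" h0] l1_h0 by simp
  then have "real_of_int (l1 h) \<le> W * ?f + N" using near by linarith
  then have "\<epsilon> * l1 h \<le> \<epsilon> * (W * ?f + N)" using \<epsilon>(1) by (intro mult_left_mono) auto
  moreover have "(2 * W * \<epsilon>) * ?f \<le> 1 * ?f" using \<epsilon>(2) by (intro mult_right_mono) auto
  ultimately have f: "?f \<le> 2 * \<epsilon> * N + 2 * D" using D[of h] by (simp add: algebra_simps)
  have "P * ?f \<le> P * (2 * \<epsilon> * N + 2 * D)" using f P0 by (intro mult_left_mono)
  moreover have "(4 * P * \<epsilon>) * N \<le> 1 * real N" using \<epsilon>(3) by (intro mult_right_mono) auto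
  ultimately have Pf: "P * ?f + C * W < N" using N by (simp add: algebra_simps)

  have far: "\<Lambda> * C * len R (h + s, 0) < \<bar>\<phi> \<mu> (h + s)\<bar>" if \<mu>: "\<mu> = \<sigma> \<or> \<mu> = \<tau>" and s: "l1 s < int W" for \<mu> s
  proof -
    have "\<phi> \<mu> (h + s) = \<phi> \<mu> h0 + \<phi> \<mu> (h - h0) + \<phi> \<mu> s" by (simp flip: add)
    moreover have "C * l1 (h - h0) \<le> C * (W * ?f)" using near C0 by (intro mult_left_mono)
    moreover have "C * l1 s \<le> C * W" using s C0 by (intro mult_left_mono) auto
    ultimately have "N - C * (W * ?f) - C * W \<le> \<bar>\<phi> \<mu> (h + s)\<bar>"
      using \<phi>_h0[of \<mu>] C[OF \<mu>, of "h - h0"] C[OF \<mu>, of s] by linarith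
    moreover have "\<Lambda> * C * len R (h + s, 0) \<le> \<Lambda> * C * ?f"
      using max[OF s] \<Lambda>0 C0 by (intro mult_left_mono) auto
    ultimately show ?thesis using Pf by (simp add: P_def algebra_simps)
  qed

  have "n < depth (semidirect R) {gen_a, gen_b, gen_c} (h, 0)"
  proof (rule G.depth_greaterI[OF generators[OF R]])
    show "\<exists>g \<in> carrier (semidirect R). len R (h, 0) < len R g"
      using abs_le_len[OF R, of "int (len R (h, 0)) + 1" 0]
      by (intro bexI[of _ "(0, int (len R (h, 0)) + 1)"]) auto
  next
    fix g assume g: "len R g \<le> n"
    obtain s k where sk: "g = (s, k)" by (metis surj_pair)
    have s: "l1 s < int W" using W g sk by blast
    have k: "\<bar>k\<bar> \<le> int n" using abs_le_len[OF R, of k s] g sk by simp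
    have "len R (h + s, k) \<le> len R (h + s, 0)"
    proof (rule len_move_cursor[OF R, where \<phi> = "\<phi> \<sigma>" and \<psi> = "\<phi> \<tau>" and \<Lambda> = \<Lambda> and C = C and K = "int n"])
      show "\<bar>\<sigma>\<bar> powi - int n \<le> \<Lambda>" "\<bar>\<tau>\<bar> powi int n \<le> \<Lambda>" by (simp_all add: \<Lambda>_def)
    qed (use eigen root add C \<sigma> \<tau> C0 far s k in auto)
    also have "\<dots> \<le> len R (h, 0)" by (rule max[OF s])
    finally show "len R ((h, 0) \<otimes>\<^bsub>semidirect R\<^esub> g) \<le> len R (h, 0)"
      by (simp add: sk semidirect_mult)
  qed simp
  then show thesis by (rule that)
qed

theorem proposition5:
  fixes R :: "int^2^2"
  assumes "hyperbolic R"
  shows "\<forall>K::int. \<exists>g \<in> carrier (semidirect R).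
           K < int (depth (semidirect R) {gen_a, gen_b, gen_c} g)"
proof
  fix K :: int
  obtain h where "nat K < depth (semidirect R) {gen_a, gen_b, gen_c} (h, 0)"
    using deep_element[OF assms] by blast
  then show "\<exists>g \<in> carrier (semidirect R). K < int (depth (semidirect R) {gen_a, gen_b, gen_c} g)"
    by (intro bexI[of _ "(h, 0)"]) auto
qed

end
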